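(* Let $X$ and $Y$ be infinite-dimensional Banach spaces over $\mathbb{C}$, where $Y=Z'$ is the dual of a normed linear space $Z$, and let $T\in B(X,Y)$. Let $(Q_n)$ be a sequence in $B(Y)$ with $\|Q_n\|\le1$ for each $n\in\mathbb{N}$, and suppose $T_n:=Q_nT$ converges to $T$ as $n\to\infty$ in the weak$^*$ sense of convergence. Then for each $k\in\mathbb{N}$, $$\lim_{n\to\infty}d_k(T_n)=d_k(T).$$
   Context: $B(X,Y)$ is the space of bounded linear operators from $X$ to $Y$ with the operator norm, $B(X)=B(X,X)$ and $X'=B(X,\mathbb{C})$. For $k\in\mathbb{N}=\{1,2,\dots\}$, the $k$-th Kolmogorov number of $T\in B(X,Y)$ is $d_k(T)=\inf\{\|Q_N^YT\| : N\text{ a closed subspace of }Y,\ \dim(N)<k\}$, where $Q_N^Y$ denotes the canonical surjection from $Y$ onto the quotient space $Y/N$. When $Y=Z'$, a sequence $(T_n)$ in $B(X,Y)$ converges to $T$ in the weak$^*$ sense if for each $x\in X$ and $z\in Z$, $|(T_nx)(z)-(Tx)(z)|\to0$. *)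

theory Defs
  imports "HOL-Analysis.Analysis"
begin

text \<open>The distribution only has real normed spaces. A complex normed space is a real normed space
  with a compatible complex scalar multiplication.\<close>

class complex_normed_vector = real_normed_vector +
  fixes scaleC :: "complex \<Rightarrow> 'a \<Rightarrow> 'a"  (infixr "*\<^sub>C" 75)
  assumes scaleC_add_right: "c *\<^sub>C (x + y) = c *\<^sub>C x + c *\<^sub>C y"
    and scaleC_add_left: "(c + d) *\<^sub>C x = c *\<^sub>C x + d *\<^sub>C x"
    and scaleC_scaleC: "c *\<^sub>C d *\<^sub>C x = (c * d) *\<^sub>C x"
    and scaleC_of_real: "complex_of_real r *\<^sub>C x = r *\<^sub>R x"
    and norm_scaleC: "norm (c *\<^sub>C x) = cmod c * norm x"

class complex_banach = complex_normed_vector + complete_space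

instance complex_banach \<subseteq> banach ..

lemma scaleC_one: "1 *\<^sub>C x = (x :: 'a::complex_normed_vector)"
  using scaleC_of_real[of 1 x] by simp

global_interpretation complex_vector:
  vector_space "scaleC :: complex \<Rightarrow> 'a \<Rightarrow> 'a::complex_normed_vector"
  defines complex_dim = "complex_vector.dim"
    and complex_span = "complex_vector.span"
    and complex_subspace = "complex_vector.subspace"
  by unfold_locales
    (simp_all add: scaleC_add_right scaleC_add_left scaleC_scaleC scaleC_one)

instantiation complex :: complex_banach
begin

definition scaleC_complex :: "complex \<Rightarrow> complex \<Rightarrow> complex" where
  "scaleC_complex c x = c * x"

instance
  by intro_classes
    (auto simp: scaleC_complex_def algebra_simps norm_mult scaleR_conv_of_real)

end

text \<open>Bounded complex-linear operators, as a subspace of the bounded real-linear ones (with the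
  operator norm).\<close>

typedef (overloaded) ('a, 'b) cblinfun =
    "{f :: 'a::complex_normed_vector \<Rightarrow>\<^sub>L 'b::complex_normed_vector.
      \<forall>c x. blinfun_apply f (c *\<^sub>C x) = c *\<^sub>C blinfun_apply f x}"
  morphisms blinfun_of_cblinfun Cblinfun
  by (rule exI[of _ 0]) simp

lemma bounded_linear_scaleC: "bounded_linear (\<lambda>x. c *\<^sub>C x :: 'a::complex_normed_vector)"
proof (rule bounded_linear_intro[where K = "cmod c"])
  fix r :: real and x y :: 'a
  show "c *\<^sub>C (x + y) = c *\<^sub>C x + c *\<^sub>C y" by (rule scaleC_add_right)
  show "c *\<^sub>C (r *\<^sub>R x) = r *\<^sub>R (c *\<^sub>C x)"
    by (simp add: scaleC_scaleC mult.commute flip: scaleC_of_real)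
  show "norm (c *\<^sub>C x) \<le> norm x * cmod c" by (simp add: norm_scaleC)
qed

lemma blinfun_apply_scaleC:
  "blinfun_apply (Blinfun (\<lambda>x. c *\<^sub>C blinfun_apply f x)) x = c *\<^sub>C blinfun_apply f x"
  by (subst bounded_linear_Blinfun_apply)
    (auto intro: bounded_linear_compose[OF bounded_linear_scaleC] blinfun.bounded_linear_right)

lemma norm_blinfun_scaleC:
  "norm (Blinfun (\<lambda>x. c *\<^sub>C blinfun_apply f x)) = cmod c * norm f"
proof (cases "c = 0")
  case True
  have "Blinfun (\<lambda>x. c *\<^sub>C blinfun_apply f x) = 0"
    by (rule blinfun_eqI, subst blinfun_apply_scaleC) (simp add: True)
  then show ?thesis by (simp add: True)
next
  case False
  let ?g = "Blinfun (\<lambda>x. c *\<^sub>C blinfun_apply f x)"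
  have le: "norm ?g \<le> cmod c * norm f"
    by (rule norm_blinfun_bound)
      (simp_all add: blinfun_apply_scaleC norm_scaleC mult.assoc mult_left_mono norm_blinfun)
  have "norm f \<le> norm ?g / cmod c"
  proof (rule norm_blinfun_bound)
    fix x
    have "cmod c * norm (blinfun_apply f x) \<le> norm ?g * norm x"
      using norm_blinfun[of ?g x] by (simp add: blinfun_apply_scaleC norm_scaleC)
    then show "norm (blinfun_apply f x) \<le> norm ?g / cmod c * norm x"
      using False by (simp add: field_simps)
  qed simp
  then have "cmod c * norm f \<le> norm ?g"
    using False by (simp add: field_simps)
  with le show ?thesis by simp
qed

setup_lifting type_definition_cblinfun

lift_definition cblinfun_apply ::
    "('a::complex_normed_vector, 'b::complex_normed_vector) cblinfun \<Rightarrow> 'a \<Rightarrow> 'b"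
    (infixr "*\<^sub>V" 70)
  is blinfun_apply .

lift_definition cblinfun_compose ::
    "('b::complex_normed_vector, 'c::complex_normed_vector) cblinfun \<Rightarrow>
     ('a::complex_normed_vector, 'b) cblinfun \<Rightarrow> ('a, 'c) cblinfun"
    (infixl "o\<^sub>C\<^sub>L" 67)
  is blinfun_compose by simp

instantiation cblinfun :: (complex_normed_vector, complex_normed_vector) complex_normed_vector
begin

lift_definition zero_cblinfun :: "('a, 'b) cblinfun" is 0
  by simp

lift_definition plus_cblinfun :: "('a, 'b) cblinfun \<Rightarrow> ('a, 'b) cblinfun \<Rightarrow> ('a, 'b) cblinfun"
  is plus by (simp add: blinfun.add_left complex_vector.scale_right_distrib)

lift_definition minus_cblinfun :: "('a, 'b) cblinfun \<Rightarrow> ('a, 'b) cblinfun \<Rightarrow> ('a, 'b) cblinfun"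
  is minus by (simp add: blinfun.diff_left complex_vector.scale_right_diff_distrib)

lift_definition uminus_cblinfun :: "('a, 'b) cblinfun \<Rightarrow> ('a, 'b) cblinfun"
  is uminus by (simp add: blinfun.minus_left)

lift_definition scaleR_cblinfun :: "real \<Rightarrow> ('a, 'b) cblinfun \<Rightarrow> ('a, 'b) cblinfun"
  is scaleR
  by (simp add: blinfun.scaleR_left mult.commute flip: scaleC_of_real)

lift_definition scaleC_cblinfun :: "complex \<Rightarrow> ('a, 'b) cblinfun \<Rightarrow> ('a, 'b) cblinfun"
  is "\<lambda>c f. Blinfun (\<lambda>x. c *\<^sub>C blinfun_apply f x)"
  by (simp add: blinfun_apply_scaleC mult.commute)

lift_definition norm_cblinfun :: "('a, 'b) cblinfun \<Rightarrow> real" is norm .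

lift_definition dist_cblinfun :: "('a, 'b) cblinfun \<Rightarrow> ('a, 'b) cblinfun \<Rightarrow> real" is dist .

lift_definition sgn_cblinfun :: "('a, 'b) cblinfun \<Rightarrow> ('a, 'b) cblinfun" is sgn
  by (simp add: sgn_div_norm blinfun.scaleR_left mult.commute flip: scaleC_of_real)

definition uniformity_cblinfun :: "(('a, 'b) cblinfun \<times> ('a, 'b) cblinfun) filter"
  where "uniformity_cblinfun = (INF e\<in>{0<..}. principal {(x, y). dist x y < e})"

definition open_cblinfun :: "('a, 'b) cblinfun set \<Rightarrow> bool"
  where "open_cblinfun S \<longleftrightarrow> (\<forall>x\<in>S. \<forall>\<^sub>F (x', y) in uniformity. x' = x \<longrightarrow> y \<in> S)"

instance
proof
  fix f g h :: "('a, 'b) cblinfun" and a b :: real and c d :: complex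
  show "f + g + h = f + (g + h)" by transfer (rule add.assoc)
  show "f + g = g + f" by transfer (rule add.commute)
  show "0 + f = f" by transfer simp
  show "- f + f = 0" by transfer simp
  show "f - g = f + - g" by transfer simp
  show "a *\<^sub>R (f + g) = a *\<^sub>R f + a *\<^sub>R g" by transfer (rule scaleR_add_right)
  show "(a + b) *\<^sub>R f = a *\<^sub>R f + b *\<^sub>R f" by transfer (rule scaleR_add_left)
  show "a *\<^sub>R b *\<^sub>R f = (a * b) *\<^sub>R f" by transfer simp
  show "1 *\<^sub>R f = f" by transfer simp
  show "dist f g = norm (f - g)" by transfer (rule dist_norm)
  show "sgn f = inverse (norm f) *\<^sub>R f" by transfer (rule sgn_div_norm)
  show "norm f = 0 \<longleftrightarrow> f = 0" by transfer simp
  show "norm (f + g) \<le> norm f + norm g" by transfer (rule norm_triangle_ineq)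
  show "norm (a *\<^sub>R f) = \<bar>a\<bar> * norm f" by transfer simp
  show "c *\<^sub>C (f + g) = c *\<^sub>C f + c *\<^sub>C g"
    by transfer (rule blinfun_eqI,
      subst blinfun.add_left, simp only: blinfun_apply_scaleC,
      simp only: blinfun.add_left scaleC_add_right)
  show "(c + d) *\<^sub>C f = c *\<^sub>C f + d *\<^sub>C f"
    by transfer (rule blinfun_eqI,
      subst blinfun.add_left, simp only: blinfun_apply_scaleC,
      rule scaleC_add_left)
  show "c *\<^sub>C d *\<^sub>C f = (c * d) *\<^sub>C f"
    by transfer (rule blinfun_eqI, simp add: blinfun_apply_scaleC)
  show "complex_of_real a *\<^sub>C f = a *\<^sub>R f"
    by transfer (rule blinfun_eqI,
      simp only: blinfun_apply_scaleC blinfun.scaleR_left,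
      rule scaleC_of_real)
  show "norm (c *\<^sub>C f) = cmod c * norm f"
    by transfer (rule norm_blinfun_scaleC)
qed (simp_all add: uniformity_cblinfun_def open_cblinfun_def)

end

instance cblinfun :: (complex_normed_vector, complex_banach) complex_banach
proof
  fix X :: "nat \<Rightarrow> ('a, 'b) cblinfun"
  assume "Cauchy X"
  then have "Cauchy (\<lambda>n. blinfun_of_cblinfun (X n))"
    by (simp add: Cauchy_def dist_cblinfun.rep_eq)
  then obtain L where L: "(\<lambda>n. blinfun_of_cblinfun (X n)) \<longlonglongrightarrow> L"
    using Cauchy_convergent convergentD by blast
  have "blinfun_apply L (c *\<^sub>C x) = c *\<^sub>C blinfun_apply L x" for c x
  proof (rule LIMSEQ_unique)
    have lim: "(\<lambda>n. blinfun_apply (blinfun_of_cblinfun (X n)) y) \<longlonglongrightarrow> blinfun_apply L y" for y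
      using L by (intro blinfun.tendsto) auto
    show "(\<lambda>n. blinfun_apply (blinfun_of_cblinfun (X n)) (c *\<^sub>C x)) \<longlonglongrightarrow> blinfun_apply L (c *\<^sub>C x)"
      by (rule lim)
    have "(\<lambda>n. c *\<^sub>C blinfun_apply (blinfun_of_cblinfun (X n)) x) \<longlonglongrightarrow> c *\<^sub>C blinfun_apply L x"
      by (rule bounded_linear.tendsto[OF bounded_linear_scaleC lim])
    moreover have "blinfun_apply (blinfun_of_cblinfun (X n)) (c *\<^sub>C x) =
        c *\<^sub>C blinfun_apply (blinfun_of_cblinfun (X n)) x" for n
      using blinfun_of_cblinfun[of "X n"] by simp
    ultimately show "(\<lambda>n. blinfun_apply (blinfun_of_cblinfun (X n)) (c *\<^sub>C x))
        \<longlonglongrightarrow> c *\<^sub>C blinfun_apply L x"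
      by simp
  qed
  then have "blinfun_of_cblinfun (Cblinfun L) = L"
    by (simp add: Cblinfun_inverse)
  with L have "X \<longlonglongrightarrow> Cblinfun L"
    by (simp add: tendsto_iff dist_cblinfun.rep_eq)
  then show "convergent X" by (rule convergentI)
qed

type_synonym 'z cdual = "('z, complex) cblinfun"

text \<open>\<open>complex_dim\<close> is 0 on infinite-dimensional subspaces, so finite-dimensionality has to be
  required separately.\<close>

definition finite_cdim :: "'a::complex_normed_vector set \<Rightarrow> bool" where
  "finite_cdim N \<longleftrightarrow> (\<exists>B. finite B \<and> complex_span B = N)"

text \<open>The quotient by \<open>N\<close> depends on a term, so it is not a type: its elements are the cosets
  of \<open>N\<close>, with the quotient norm. The canonical surjection is \<open>coset N\<close>.\<close>

definition coset :: "'a::complex_normed_vector set \<Rightarrow> 'a \<Rightarrow> 'a set" where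
  "coset N y = (\<lambda>n. y + n) ` N"

definition quotient_norm :: "'a::complex_normed_vector set \<Rightarrow> real" where
  "quotient_norm C = (INF v\<in>C. norm v)"

text \<open>The operator norm of \<open>x \<mapsto> coset N (T x)\<close>, as in \<open>onorm\<close>.\<close>

definition quotient_onorm ::
    "'b::complex_normed_vector set \<Rightarrow> ('a::complex_normed_vector, 'b) cblinfun \<Rightarrow> real" where
  "quotient_onorm N T = (SUP x. quotient_norm (coset N (T *\<^sub>V x)) / norm x)"

definition kolmogorov_number ::
    "nat \<Rightarrow> ('a::complex_normed_vector, 'b::complex_normed_vector) cblinfun \<Rightarrow> real" where
  "kolmogorov_number k T =
    (INF N\<in>{N. closed N \<and> complex_subspace N \<and> finite_cdim N \<and> complex_dim N < k}.
      quotient_onorm N T)"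

definition weak_star_converges ::
    "(nat \<Rightarrow> ('a::complex_normed_vector, 'z::complex_normed_vector cdual) cblinfun) \<Rightarrow>
     ('a, 'z cdual) cblinfun \<Rightarrow> bool" where
  "weak_star_converges S T \<longleftrightarrow>
    (\<forall>x z. (\<lambda>n. cmod ((S n *\<^sub>V x) *\<^sub>V z - (T *\<^sub>V x) *\<^sub>V z)) \<longlonglongrightarrow> 0)"

end

theory Submission
  imports Defs
begin

text \<open>Composing with a contraction does not increase \<open>d\<^sub>k\<close>, so only lower semicontinuity is at stake.
  If \<open>d\<^sub>k (T\<^sub>n) \<le> c < c' < d\<^sub>k T\<close> for infinitely many \<open>n\<close>, choose subspaces \<open>N\<^sub>n\<close> of
  dimension less than \<open>k\<close> that approximate \<open>T\<^sub>n\<close> up to \<open>c'\<close>, and an ultrafilter \<open>U\<close>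
  containing these \<open>n\<close>. The weak* limits along \<open>U\<close> of bounded sequences \<open>y\<^sub>n \<in> N\<^sub>n\<close> form a
  subspace \<open>N\<close>. Normalised linear dependences among \<open>k\<close> vectors of \<open>N\<^sub>n\<close> survive in the limit, so
  \<open>N\<close> has dimension less than \<open>k\<close>. As the norm is weak* lower semicontinuous, \<open>N\<close> approximates
  \<open>T\<close> up to \<open>c'\<close>, a contradiction.\<close>

section \<open>Ultrafilters\<close>

text \<open>Stated as a property of HOL filters, so that \<open>eventually\<close> and
  \<open>filterlim\<close> serve directly for limits along an ultrafilter.\<close>

definition ultrafilter :: "'a filter \<Rightarrow> bool" where
  "ultrafilter U \<longleftrightarrow> U \<noteq> bot \<and> (\<forall>P. eventually P U \<or> eventually (\<lambda>x. \<not> P x) U)"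

text \<open>Zorn's lemma for the proper filters below \<open>F\<close>. A finer filter is smaller in
  the order on filters, so the maximal object sought is a minimal proper filter, and a chain is
  bounded by its infimum.\<close>

lemma ultrafilter_exists:
  assumes "F \<noteq> bot"
  obtains U where "U \<le> F" "ultrafilter U"
proof -
  define A where "A = {G. G \<noteq> bot \<and> G \<le> F}"
  have "\<exists>U\<in>A. \<forall>G\<in>A. U \<ge> G \<longrightarrow> G = U"
  proof (rule predicate_Zorn)
    show "partial_order_on A (relation_of (\<ge>) A)"
      by (rule partial_order_on_relation_ofI) auto
    fix C assume C: "C \<in> Chains (relation_of (\<ge>) A)"
    have CA: "C \<subseteq> A" and chain: "\<And>G H. G \<in> C \<Longrightarrow> H \<in> C \<Longrightarrow> G \<le> H \<or> H \<le> G"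
      using C by (auto simp: Chains_def relation_of_def)
    show "\<exists>u\<in>A. \<forall>a\<in>C. u \<le> a"
    proof (cases "C = {}")
      case True
      then show ?thesis using assms by (auto simp: A_def)
    next
      case False
      \<comment> \<open>A chain is directed downwards, so whatever holds eventually in its infimum
        already holds eventually in one member. Hence the infimum is proper.\<close>
      have "eventually (\<lambda>_. False) (Inf C) \<longleftrightarrow> (\<exists>G\<in>C. eventually (\<lambda>_. False) G)"
        using chain False by (intro eventually_Inf_base) (metis inf.orderE inf.commute order_refl)+
      then have "Inf C \<noteq> bot"
        using CA by (auto simp: A_def trivial_limit_def)
      moreover have "Inf C \<le> F"
        using False CA by (auto simp: A_def intro: Inf_lower2)
      ultimately show ?thesis
        by (auto simp: A_def Inf_lower)
    qed
  qed
  then obtain U where U: "U \<noteq> bot" "U \<le> F" and minU: "\<And>G. G \<noteq> bot \<Longrightarrow> G \<le> U \<Longrightarrow> G = U"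
    unfolding A_def by (auto dest: order_trans)
  have "eventually P U \<or> eventually (\<lambda>x. \<not> P x) U" for P
  proof (rule disjCI)
    assume "\<not> eventually (\<lambda>x. \<not> P x) U"
    \<comment> \<open>Restricting \<open>U\<close> to \<open>P\<close> keeps it proper, so
      minimality forces the restriction to be \<open>U\<close> itself.\<close>
    then have "inf U (principal {x. P x}) \<noteq> bot"
      by (simp add: trivial_limit_def eventually_inf_principal)
    then have "inf U (principal {x. P x}) = U"
      by (rule minU) simp
    then show "eventually P U"
      using eventually_inf_principal[of P U "{x. P x}"] by simp
  qed
  with U show ?thesis
    by (intro that) (auto simp: ultrafilter_def)
qed

text \<open>Compactness yields a cluster point of \<open>f\<close> along \<open>U\<close>. It is a
  limit because an ultrafilter decides for each neighbourhood whether \<open>f\<close> eventually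
  lies in it, and the negative answer contradicts clustering.\<close>

lemma ultrafilter_tendsto_compact:
  assumes U: "ultrafilter U" and "compact K" and ev: "eventually (\<lambda>n. f n \<in> K) U"
  obtains l where "l \<in> K" "(f \<longlongrightarrow> l) U"
proof -
  have "filtermap f U \<noteq> bot"
    using U by (simp add: ultrafilter_def filtermap_bot_iff)
  moreover have "eventually (\<lambda>x. x \<in> K) (filtermap f U)"
    using ev by (simp add: eventually_filtermap)
  ultimately obtain l where l: "l \<in> K" "inf (nhds l) (filtermap f U) \<noteq> bot"
    using \<open>compact K\<close> unfolding compact_filter by blast
  have "(f \<longlongrightarrow> l) U"
    unfolding filterlim_def le_filter_def
  proof (intro allI impI)
    fix P assume P: "eventually P (nhds l)"
    show "eventually P (filtermap f U)"
    proof (rule ccontr)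
      assume "\<not> eventually P (filtermap f U)"
      then have "eventually (\<lambda>x. \<not> P x) (filtermap f U)"
        using U by (auto simp: ultrafilter_def eventually_filtermap)
      with P have "eventually (\<lambda>_. False) (inf (nhds l) (filtermap f U))"
        unfolding eventually_inf by (intro exI[of _ P] exI[of _ "\<lambda>x. \<not> P x"]) simp
      with l(2) show False
        by (simp add: trivial_limit_def)
    qed
  qed
  with l(1) show ?thesis by (rule that)
qed

lemma ultrafilter_tendsto_bounded:
  fixes f :: "'a \<Rightarrow> complex"
  assumes "ultrafilter U" and "eventually (\<lambda>n. cmod (f n) \<le> r) U"
  obtains l where "(f \<longlongrightarrow> l) U"
  using ultrafilter_tendsto_compact[OF assms(1) compact_cball[of 0 r], of f] assms(2)
  by auto

section \<open>Bounded complex-linear operators\<close>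

lemma cblinfun_apply_add: "T *\<^sub>V (x + y) = T *\<^sub>V x + T *\<^sub>V y"
  by transfer (rule blinfun.add_right)

lemma cblinfun_apply_scaleC: "T *\<^sub>V (c *\<^sub>C x) = c *\<^sub>C (T *\<^sub>V x)"
  by transfer simp

lemma cblinfun_apply_zero [simp]: "T *\<^sub>V 0 = 0"
  by transfer simp

lemma norm_cblinfun_apply_le: "norm (T *\<^sub>V x) \<le> norm T * norm x"
  by transfer (rule norm_blinfun)

lemma norm_cblinfun_bound:
  "0 \<le> b \<Longrightarrow> (\<And>x. norm (T *\<^sub>V x) \<le> b * norm x) \<Longrightarrow> norm T \<le> b"
  by transfer (rule norm_blinfun_bound)

lemma cblinfun_eqI: "(\<And>x. S *\<^sub>V x = T *\<^sub>V x) \<Longrightarrow> S = T"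
  by transfer (rule blinfun_eqI)

lemma cblinfun_add_apply: "(S + T) *\<^sub>V x = S *\<^sub>V x + T *\<^sub>V x"
  by transfer (rule blinfun.add_left)

lemma cblinfun_diff_apply: "(S - T) *\<^sub>V x = S *\<^sub>V x - T *\<^sub>V x"
  by transfer (rule blinfun.diff_left)

lemma cblinfun_zero_apply [simp]: "0 *\<^sub>V x = 0"
  by transfer simp

lemma cblinfun_scaleC_apply: "(c *\<^sub>C T) *\<^sub>V x = c *\<^sub>C (T *\<^sub>V x)"
  by transfer (rule blinfun_apply_scaleC)

lemma cblinfun_sum_apply: "(\<Sum>i\<in>I. f i) *\<^sub>V x = (\<Sum>i\<in>I. f i *\<^sub>V x)"
  by (induction I rule: infinite_finite_induct) (auto simp: cblinfun_add_apply)

lemma cblinfun_compose_apply: "(S o\<^sub>C\<^sub>L T) *\<^sub>V x = S *\<^sub>V (T *\<^sub>V x)"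
  by transfer simp

lemma cblinfun_apply_span:
  "v \<in> complex_span B \<Longrightarrow> T *\<^sub>V v \<in> complex_span ((*\<^sub>V) T ` B)"
proof (induction rule: complex_vector.span_induct_alt)
  case base
  show ?case by (simp add: complex_vector.span_zero)
next
  case (step c x y)
  then show ?case
    unfolding cblinfun_apply_add cblinfun_apply_scaleC
    by (metis complex_vector.span_add complex_vector.span_scale complex_vector.span_base imageI)
qed

text \<open>Serves to turn a pointwise limit of functionals into an element of the dual.\<close>

lemma cblinfun_exists:
  fixes f :: "'a::complex_normed_vector \<Rightarrow> 'b::complex_normed_vector"
  assumes add: "\<And>x y. f (x + y) = f x + f y"
    and scale: "\<And>c x. f (c *\<^sub>C x) = c *\<^sub>C f x"
    and bound: "\<And>x. norm (f x) \<le> r * norm x"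
  obtains F :: "('a, 'b) cblinfun" where "\<And>x. F *\<^sub>V x = f x"
proof -
  have bl: "bounded_linear f"
  proof (rule bounded_linear_intro[where K = r])
    show "f (c *\<^sub>R x) = c *\<^sub>R f x" for c x
      using scale[of "complex_of_real c" x] by (simp only: scaleC_of_real)
    show "norm (f x) \<le> norm x * r" for x
      using bound[of x] by (simp only: mult.commute)
  qed (rule add)
  then have "blinfun_apply (Blinfun f) = f"
    by (rule bounded_linear_Blinfun_apply)
  then have "Cblinfun (Blinfun f) *\<^sub>V x = f x" for x
    by (simp add: cblinfun_apply.rep_eq Cblinfun_inverse scale)
  then show ?thesis by (rule that)
qed

text \<open>If \<open>b\<close> lies outside the closed span of \<open>B\<close>, it has positive
  distance \<delta> from it, and this controls the \<open>b\<close>-coefficient of a vector by its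
  norm. Along a convergent sequence the coefficients are then Cauchy, and the remainders converge
  inside the closed span of \<open>B\<close>.\<close>

lemma closed_span_insert:
  fixes b :: "'a::complex_normed_vector"
  assumes cl: "closed (complex_span B)"
  shows "closed (complex_span (insert b B))"
proof (cases "b \<in> complex_span B")
  case True
  then show ?thesis using cl by (simp add: complex_vector.span_redundant)
next
  case False
  let ?S = "complex_span B"
  have "open (- ?S)" "b \<in> - ?S"
    using cl False by auto
  then obtain \<delta> where "\<delta> > 0" "ball b \<delta> \<subseteq> - ?S"
    by (rule openE)
  then have \<delta>: "\<delta> > 0" "\<And>s. s \<in> ?S \<Longrightarrow> \<delta> \<le> dist b s"
    by (auto simp: subset_eq not_less[symmetric])
  \<comment> \<open>Dividing by \<open>a\<close> turns the right-hand side into the distance from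
    \<open>b\<close> to a point of the span of \<open>B\<close>.\<close>
  have lower: "\<delta> * cmod a \<le> norm (a *\<^sub>C b + s)" if s: "s \<in> ?S" for a s
  proof (cases "a = 0")
    case False
    have "- (inverse a *\<^sub>C s) \<in> ?S"
      using s by (simp add: complex_vector.span_neg complex_vector.span_scale)
    then have "\<delta> \<le> norm (b + inverse a *\<^sub>C s)"
      using \<delta>(2) by (force simp: dist_norm)
    also have "\<dots> = norm (a *\<^sub>C b + s) / cmod a"
    proof -
      have "a *\<^sub>C b + s = a *\<^sub>C (b + inverse a *\<^sub>C s)"
        using False by (simp add: scaleC_add_right scaleC_scaleC scaleC_one)
      then show ?thesis using False by (simp add: norm_scaleC)
    qed
    finally show ?thesis using False by (simp add: field_simps)
  qed simp
  show ?thesis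
    unfolding closed_sequential_limits
  proof (intro allI impI, elim conjE)
    fix x l assume x: "\<forall>n. x n \<in> complex_span (insert b B)" and l: "x \<longlonglongrightarrow> l"
    then obtain a where a: "\<And>n. x n - a n *\<^sub>C b \<in> ?S"
      unfolding complex_vector.span_breakdown_eq by metis
    have "\<delta> * cmod (a m - a n) \<le> norm (x m - x n)" for m n
    proof -
      have "(x m - a m *\<^sub>C b) - (x n - a n *\<^sub>C b) \<in> ?S"
        by (intro complex_vector.span_diff a)
      from lower[OF this, of "a m - a n"] show ?thesis
        by (simp add: complex_vector.scale_left_diff_distrib)
    qed
    then have ax: "dist (a m) (a n) \<le> dist (x m) (x n) / \<delta>" for m n
      using \<delta>(1) by (simp add: dist_norm field_simps)
    have "Cauchy a"
    proof (rule metric_CauchyI)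
      fix e :: real assume "e > 0"
      then have "e * \<delta> > 0" using \<delta>(1) by simp
      then obtain M where M: "\<And>m n. m \<ge> M \<Longrightarrow> n \<ge> M \<Longrightarrow> dist (x m) (x n) < e * \<delta>"
        using LIMSEQ_imp_Cauchy[OF l] unfolding Cauchy_def by blast
      have "dist (a m) (a n) < e" if "m \<ge> M" "n \<ge> M" for m n
      proof -
        have "dist (x m) (x n) / \<delta> < e"
          using M[OF that] \<delta>(1) by (simp add: pos_divide_less_eq)
        with ax[of m n] show ?thesis by simp
      qed
      then show "\<exists>M. \<forall>m\<ge>M. \<forall>n\<ge>M. dist (a m) (a n) < e" by blast
    qed
    then obtain \<alpha> where \<alpha>: "a \<longlonglongrightarrow> \<alpha>"
      using Cauchy_convergent convergentD by blast
    have "(\<lambda>n. a n *\<^sub>C b) \<longlonglongrightarrow> \<alpha> *\<^sub>C b"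
    proof -
      have "bounded_linear (\<lambda>c. c *\<^sub>C b)"
      proof (rule bounded_linear_intro[where K = "norm b"])
        show "(r *\<^sub>R c) *\<^sub>C b = r *\<^sub>R (c *\<^sub>C b)" for r c
          by (simp only: scaleC_of_real[symmetric] scaleC_scaleC scaleC_complex_def)
      qed (simp_all add: scaleC_add_left norm_scaleC)
      from bounded_linear.tendsto[OF this \<alpha>] show ?thesis .
    qed
    then have "(\<lambda>n. x n - a n *\<^sub>C b) \<longlonglongrightarrow> l - \<alpha> *\<^sub>C b"
      by (rule tendsto_diff[OF l])
    then have "l - \<alpha> *\<^sub>C b \<in> ?S"
      by (rule closed_sequentially[OF cl a])
    then show "l \<in> complex_span (insert b B)"
      unfolding complex_vector.span_breakdown_eq by blast
  qed
qed

lemma closed_span_finite: "finite B \<Longrightarrow> closed (complex_span B)"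
  by (induction B rule: finite_induct) (auto intro: closed_span_insert)

text \<open>Allows finite spanning sets to replace dimensions from here on. One direction takes a
  basis, whose finiteness comes from \<open>finite_cdim\<close>; the other uses that finitely
  spanned subspaces are closed.\<close>

lemma finite_dim_less_iff:
  "closed N \<and> complex_subspace N \<and> finite_cdim N \<and> complex_dim N < k \<longleftrightarrow>
    (\<exists>B. finite B \<and> card B < k \<and> N = complex_span B)"
proof
  assume N: "closed N \<and> complex_subspace N \<and> finite_cdim N \<and> complex_dim N < k"
  obtain B where B: "B \<subseteq> N" "complex_vector.independent B" "N \<subseteq> complex_span B"
    "card B = complex_dim N"
    by (rule complex_vector.basis_exists)
  obtain A where "finite A" "complex_span A = N"
    using N by (auto simp: finite_cdim_def)
  then have "finite B"
    using complex_vector.independent_span_bound B by blast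
  moreover have "N = complex_span B"
    using B N complex_vector.span_minimal by blast
  ultimately show "\<exists>B. finite B \<and> card B < k \<and> N = complex_span B"
    using B N by auto
next
  assume "\<exists>B. finite B \<and> card B < k \<and> N = complex_span B"
  then obtain B where B: "finite B" "card B < k" "N = complex_span B" by blast
  then have "complex_dim N < k"
    using complex_vector.dim_le_card'[of B] by simp
  then show "closed N \<and> complex_subspace N \<and> finite_cdim N \<and> complex_dim N < k"
    using B closed_span_finite by (auto simp: finite_cdim_def)
qed

section \<open>Kolmogorov numbers\<close>

lemma quotient_norm_coset_le: "n \<in> N \<Longrightarrow> quotient_norm (coset N y) \<le> norm (y + n)"
  unfolding quotient_norm_def coset_def
  by (rule cINF_lower) (auto intro: bdd_belowI[of _ 0])

lemma quotient_norm_coset_less: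
  assumes "quotient_norm (coset N y) < c" and "N \<noteq> {}"
  obtains n where "n \<in> N" "norm (y + n) < c"
proof -
  have "norm ` coset N y \<noteq> {}"
    using assms(2) by (simp add: coset_def)
  from cInf_lessD[OF this] assms(1) show ?thesis
    unfolding quotient_norm_def by (auto simp: coset_def intro: that)
qed

lemma quotient_onorm_le:
  assumes "0 \<le> c" and "\<And>x. quotient_norm (coset N (T *\<^sub>V x)) \<le> c * norm x"
  shows "quotient_onorm N T \<le> c"
  unfolding quotient_onorm_def
proof (rule cSUP_least)
  fix x
  \<comment> \<open>At \<open>x = 0\<close> the ratio is \<open>0\<close> by the convention on
    division, and \<open>0 \<le> c\<close> settles this case.\<close>
  show "quotient_norm (coset N (T *\<^sub>V x)) / norm x \<le> c"
    using assms by (cases "x = 0") (auto simp: divide_le_eq)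
qed simp

text \<open>Since \<open>0 \<in> N\<close>, the quotient norm is at most the norm, so all ratios are
  bounded by \<open>norm T\<close> and the real supremum is a genuine one.\<close>

lemma quotient_onorm_upper:
  assumes "0 \<in> N"
  shows "quotient_norm (coset N (T *\<^sub>V x)) / norm x \<le> quotient_onorm N T"
  unfolding quotient_onorm_def
proof (rule cSUP_upper)
  have "quotient_norm (coset N (T *\<^sub>V x)) \<le> norm T * norm x" for x
    using quotient_norm_coset_le[OF assms, of "T *\<^sub>V x"] norm_cblinfun_apply_le[of T x] by simp
  then have "quotient_norm (coset N (T *\<^sub>V x)) / norm x \<le> norm T" for x
    by (cases "x = 0") (auto simp: divide_le_eq)
  then show "bdd_above (range (\<lambda>x. quotient_norm (coset N (T *\<^sub>V x)) / norm x))"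
    by (auto intro: bdd_aboveI[of _ "norm T"])
qed simp

lemma quotient_onorm_nonneg: "0 \<in> N \<Longrightarrow> 0 \<le> quotient_onorm N T"
  using quotient_onorm_upper[of N T 0] by simp

lemma quotient_onorm_apply:
  assumes "0 \<in> N"
  shows "quotient_norm (coset N (T *\<^sub>V x)) \<le> quotient_onorm N T * norm x"
proof (cases "x = 0")
  case True
  then show ?thesis using quotient_norm_coset_le[OF assms, of 0] by simp
next
  case False
  then show ?thesis using quotient_onorm_upper[OF assms, of T x] by (simp add: divide_le_eq)
qed

lemma kolmogorov_number_eq_INF_span:
  fixes T :: "('a::complex_normed_vector, 'b::complex_normed_vector) cblinfun"
  shows "kolmogorov_number k T = (INF B\<in>{B. finite B \<and> card B < k}. quotient_onorm (complex_span B) T)"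
proof -
  have "{N :: 'b set. closed N \<and> complex_subspace N \<and> finite_cdim N \<and> complex_dim N < k} =
      complex_span ` {B. finite B \<and> card B < k}"
    unfolding finite_dim_less_iff by auto
  then show ?thesis
    unfolding kolmogorov_number_def by (simp only: image_image)
qed

lemma kolmogorov_number_le:
  assumes "finite B" "card B < k"
  shows "kolmogorov_number k T \<le> quotient_onorm (complex_span B) T"
  unfolding kolmogorov_number_eq_INF_span
proof (rule cINF_lower)
  show "bdd_below ((\<lambda>B. quotient_onorm (complex_span B) T) ` {B. finite B \<and> card B < k})"
    by (auto intro!: bdd_belowI[of _ 0] quotient_onorm_nonneg complex_vector.span_zero)
qed (use assms in auto)

lemma kolmogorov_number_less:
  assumes "kolmogorov_number k T < c" and "k \<ge> 1"
  obtains B where "finite B" "card B < k" "quotient_onorm (complex_span B) T < c"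
proof -
  \<comment> \<open>For \<open>k \<ge> 1\<close> the empty set is admissible, so the infimum runs
    over a nonempty family.\<close>
  have "(\<lambda>B. quotient_onorm (complex_span B) T) ` {B. finite B \<and> card B < k} \<noteq> {}"
    using \<open>k \<ge> 1\<close> by (auto intro: exI[of _ "{}"])
  from cInf_lessD[OF this] assms(1) show ?thesis
    unfolding kolmogorov_number_eq_INF_span by (auto intro: that)
qed

text \<open>The distance to a subspace is an infimum; the strict inequality leaves room to choose an
  actual approximant when \<open>x \<noteq> 0\<close>.\<close>

lemma quotient_onorm_approx:
  assumes "quotient_onorm (complex_span B) T < c"
  obtains v where "v \<in> complex_span B" "norm (T *\<^sub>V x - v) \<le> c * norm x"
proof (cases "x = 0")
  case True
  then show ?thesis by (intro that[of 0]) (auto simp: complex_vector.span_zero)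
next
  case False
  have "quotient_norm (coset (complex_span B) (T *\<^sub>V x)) \<le>
      quotient_onorm (complex_span B) T * norm x"
    by (rule quotient_onorm_apply) (rule complex_vector.span_zero)
  also have "\<dots> < c * norm x"
    using assms False by simp
  finally obtain n where "n \<in> complex_span B" "norm (T *\<^sub>V x + n) < c * norm x"
    using quotient_norm_coset_less complex_vector.span_zero by blast
  then show ?thesis
    by (intro that[of "- n"]) (auto simp: complex_vector.span_neg)
qed

text \<open>The image under \<open>Q\<close> of a subspace that approximates \<open>T\<close>
  approximates the composition at least as well, because \<open>Q\<close> is a contraction, and it
  is spanned by no more vectors.\<close>

lemma kolmogorov_number_compose_le:
  assumes "norm Q \<le> 1" and "k \<ge> 1"
  shows "kolmogorov_number k (Q o\<^sub>C\<^sub>L T) \<le> kolmogorov_number k T"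
proof (rule dense_ge)
  fix c assume "kolmogorov_number k T < c"
  then obtain B where B: "finite B" "card B < k" "quotient_onorm (complex_span B) T < c"
    using \<open>k \<ge> 1\<close> by (rule kolmogorov_number_less)
  let ?N = "complex_span ((*\<^sub>V) Q ` B)"
  have "0 \<le> quotient_onorm (complex_span B) T"
    by (intro quotient_onorm_nonneg complex_vector.span_zero)
  with B(3) have "0 \<le> c" by simp
  have "quotient_onorm ?N (Q o\<^sub>C\<^sub>L T) \<le> c"
  proof (rule quotient_onorm_le[OF \<open>0 \<le> c\<close>])
    fix x
    obtain v where v: "v \<in> complex_span B" "norm (T *\<^sub>V x - v) \<le> c * norm x"
      using B(3) by (rule quotient_onorm_approx)
    have "- v \<in> complex_span B"
      using v(1) by (rule complex_vector.span_neg)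
    then have "quotient_norm (coset ?N ((Q o\<^sub>C\<^sub>L T) *\<^sub>V x)) \<le> norm (Q *\<^sub>V (T *\<^sub>V x) + Q *\<^sub>V (- v))"
      unfolding cblinfun_compose_apply by (intro quotient_norm_coset_le cblinfun_apply_span)
    also have "\<dots> = norm (Q *\<^sub>V (T *\<^sub>V x - v))"
      by (simp flip: cblinfun_apply_add)
    also have "\<dots> \<le> norm Q * norm (T *\<^sub>V x - v)"
      by (rule norm_cblinfun_apply_le)
    also have "\<dots> \<le> norm (T *\<^sub>V x - v)"
      using assms(1) by (simp add: mult_left_le_one_le)
    finally show "quotient_norm (coset ?N ((Q o\<^sub>C\<^sub>L T) *\<^sub>V x)) \<le> c * norm x"
      using v(2) by simp
  qed
  moreover have "card ((*\<^sub>V) Q ` B) < k"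
    using card_image_le[OF B(1), of "(*\<^sub>V) Q"] B(2) by simp
  ultimately show "kolmogorov_number k (Q o\<^sub>C\<^sub>L T) \<le> c"
    using kolmogorov_number_le[of "(*\<^sub>V) Q ` B" k "Q o\<^sub>C\<^sub>L T"] B(1) by simp
qed

section \<open>Weak* limits along an ultrafilter\<close>

text \<open>Formulated for any filter, since the limits are taken along an ultrafilter.\<close>

definition weak_star_limit ::
    "'i filter \<Rightarrow> ('i \<Rightarrow> 'z::complex_normed_vector cdual) \<Rightarrow> 'z cdual \<Rightarrow> bool" where
  "weak_star_limit U y L \<longleftrightarrow> (\<forall>z. ((\<lambda>n. y n *\<^sub>V z) \<longlongrightarrow> L *\<^sub>V z) U)"

text \<open>Weak-star lower semicontinuity of the norm: the bound on each value
  \<open>y n *\<^sub>V z\<close> passes to the limit.\<close>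

lemma weak_star_limit_norm_le:
  assumes "U \<noteq> bot" "weak_star_limit U y L" "eventually (\<lambda>n. norm (y n) \<le> r) U"
  shows "norm L \<le> r"
proof (rule norm_cblinfun_bound)
  obtain n where "norm (y n) \<le> r"
    using assms(1,3) eventually_happens' by blast
  then show "0 \<le> r"
    using norm_ge_zero order_trans by blast
  fix z
  have "((\<lambda>n. cmod (y n *\<^sub>V z)) \<longlongrightarrow> cmod (L *\<^sub>V z)) U"
    using assms(2) by (auto simp: weak_star_limit_def intro: tendsto_norm)
  moreover have "eventually (\<lambda>n. cmod (y n *\<^sub>V z) \<le> r * norm z) U"
    using assms(3)
  proof eventually_elim
    case (elim n)
    then show ?case
      using norm_cblinfun_apply_le[of "y n" z] by (meson mult_right_mono norm_ge_zero order_trans)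
  qed
  ultimately show "norm (L *\<^sub>V z) \<le> r * norm z"
    using assms(1) by (intro tendsto_upperbound)
qed

text \<open>Banach-Alaoglu in ultrafilter form. For each \<open>z\<close> the values stay in a
  compact disc and so converge along \<open>U\<close>; linearity and the bound survive in the
  pointwise limit.\<close>

lemma weak_star_limit_exists:
  fixes y :: "'i \<Rightarrow> 'z::complex_normed_vector cdual"
  assumes U: "ultrafilter U" and bnd: "eventually (\<lambda>n. norm (y n) \<le> r) U"
  obtains L where "weak_star_limit U y L"
proof -
  have nb: "U \<noteq> bot" using U by (simp add: ultrafilter_def)
  have ev: "eventually (\<lambda>n. cmod (y n *\<^sub>V z) \<le> r * norm z) U" for z
    using bnd
  proof eventually_elim
    case (elim n)
    then show ?case
      using norm_cblinfun_apply_le[of "y n" z] by (meson mult_right_mono norm_ge_zero order_trans)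
  qed
  have "\<exists>l. ((\<lambda>n. y n *\<^sub>V z) \<longlongrightarrow> l) U" for z
    using ultrafilter_tendsto_bounded[OF U ev] by blast
  then obtain l where l: "\<And>z. ((\<lambda>n. y n *\<^sub>V z) \<longlongrightarrow> l z) U"
    by metis
  have "l (x + z) = l x + l z" for x z
    using tendsto_unique[OF nb l[of "x + z"]] tendsto_add[OF l[of x] l[of z]]
    by (simp add: cblinfun_apply_add)
  moreover have "l (c *\<^sub>C z) = c *\<^sub>C l z" for c z
    using tendsto_unique[OF nb l[of "c *\<^sub>C z"]] tendsto_mult_left[OF l[of z], of c]
    by (simp add: cblinfun_apply_scaleC scaleC_complex_def)
  moreover have "norm (l z) \<le> r * norm z" for z
    by (rule tendsto_upperbound[OF tendsto_norm[OF l] ev nb])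
  ultimately obtain L :: "'z cdual" where "\<And>z. L *\<^sub>V z = l z"
    using cblinfun_exists[of l r] by blast
  with l have "weak_star_limit U y L" by (simp add: weak_star_limit_def)
  then show ?thesis by (rule that)
qed

lemma weak_star_limit_add:
  "weak_star_limit U y L \<Longrightarrow> weak_star_limit U y' L' \<Longrightarrow> weak_star_limit U (\<lambda>n. y n + y' n) (L + L')"
  by (auto simp: weak_star_limit_def cblinfun_add_apply intro: tendsto_add)

lemma weak_star_limit_diff:
  "weak_star_limit U y L \<Longrightarrow> weak_star_limit U y' L' \<Longrightarrow> weak_star_limit U (\<lambda>n. y n - y' n) (L - L')"
  by (auto simp: weak_star_limit_def cblinfun_diff_apply intro: tendsto_diff)

text \<open>The scalars may vary with \<open>n\<close>, as the coefficients of the linear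
  dependences do.\<close>

lemma weak_star_limit_scaleC:
  "(a \<longlongrightarrow> c) U \<Longrightarrow> weak_star_limit U y L \<Longrightarrow> weak_star_limit U (\<lambda>n. a n *\<^sub>C y n) (c *\<^sub>C L)"
  by (auto simp: weak_star_limit_def cblinfun_scaleC_apply scaleC_complex_def intro: tendsto_mult)

lemma weak_star_limit_sum:
  assumes "\<And>i. i \<in> I \<Longrightarrow> weak_star_limit U (y i) (L i)"
  shows "weak_star_limit U (\<lambda>n. \<Sum>i\<in>I. y i n) (\<Sum>i\<in>I. L i)"
  using assms by (auto simp: weak_star_limit_def cblinfun_sum_apply intro: tendsto_sum)

lemma weak_star_limit_unique:
  "U \<noteq> bot \<Longrightarrow> weak_star_limit U y L \<Longrightarrow> weak_star_limit U y L' \<Longrightarrow> L = L'"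
  unfolding weak_star_limit_def by (intro cblinfun_eqI) (blast intro: tendsto_unique)

text \<open>A weak-star ultralimit of the subspaces \<open>N n\<close>. The bound \<open>r\<close>
  may differ from one limit to another.\<close>

definition bounded_weak_star_limits ::
    "'i filter \<Rightarrow> ('i \<Rightarrow> 'z::complex_normed_vector cdual set) \<Rightarrow> 'z cdual set" where
  "bounded_weak_star_limits U N =
    {L. \<exists>y r. (\<forall>n. y n \<in> N n) \<and> eventually (\<lambda>n. norm (y n) \<le> r) U \<and> weak_star_limit U y L}"

lemma bounded_weak_star_limitsI:
  "(\<And>n. y n \<in> N n) \<Longrightarrow> eventually (\<lambda>n. norm (y n) \<le> r) U \<Longrightarrow> weak_star_limit U y L \<Longrightarrow>
    L \<in> bounded_weak_star_limits U N"
  unfolding bounded_weak_star_limits_def by blast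

lemma subspace_bounded_weak_star_limits:
  assumes N: "\<And>n. complex_subspace (N n)"
  shows "complex_subspace (bounded_weak_star_limits U N)"
proof (rule complex_vector.subspaceI)
  show "0 \<in> bounded_weak_star_limits U N"
    using complex_vector.subspace_0[OF N]
    by (rule bounded_weak_star_limitsI[where r = 0]) (simp_all add: weak_star_limit_def)
next
  fix L L' assume "L \<in> bounded_weak_star_limits U N" "L' \<in> bounded_weak_star_limits U N"
  then obtain y r y' r' where y: "\<And>n. y n \<in> N n" "weak_star_limit U y L"
      and r: "eventually (\<lambda>n. norm (y n) \<le> r) U"
      and y': "\<And>n. y' n \<in> N n" "weak_star_limit U y' L'"
      and r': "eventually (\<lambda>n. norm (y' n) \<le> r') U"
    unfolding bounded_weak_star_limits_def by blast
  have "eventually (\<lambda>n. norm (y n + y' n) \<le> r + r') U"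
    using r r' by eventually_elim (rule norm_triangle_mono)
  then show "L + L' \<in> bounded_weak_star_limits U N"
    using complex_vector.subspace_add[OF N y(1) y'(1)] weak_star_limit_add[OF y(2) y'(2)]
    by (intro bounded_weak_star_limitsI)
next
  fix c L assume "L \<in> bounded_weak_star_limits U N"
  then obtain y r where y: "\<And>n. y n \<in> N n" "weak_star_limit U y L"
      and r: "eventually (\<lambda>n. norm (y n) \<le> r) U"
    unfolding bounded_weak_star_limits_def by blast
  have "eventually (\<lambda>n. norm (c *\<^sub>C y n) \<le> cmod c * r) U"
    using r by eventually_elim (simp add: norm_scaleC mult_left_mono)
  then show "c *\<^sub>C L \<in> bounded_weak_star_limits U N"
    using complex_vector.subspace_scale[OF N y(1)] weak_star_limit_scaleC[OF tendsto_const y(2)]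
    by (intro bounded_weak_star_limitsI)
qed

text \<open>More vectors than spanning elements must be dependent. The family is indexed because the
  vectors at a given \<open>n\<close> may coincide, and the coefficients are normalised so that they
  cannot all tend to zero.\<close>

lemma normalised_dependence:
  fixes y :: "'i \<Rightarrow> 'a::complex_normed_vector"
  assumes I: "finite I" and B: "finite B" "card B < card I"
    and y: "\<And>i. i \<in> I \<Longrightarrow> y i \<in> complex_span B"
  obtains a where "(\<Sum>i\<in>I. a i *\<^sub>C y i) = 0" "(\<Sum>i\<in>I. cmod (a i)) = 1"
proof -
  have "\<exists>u. (\<exists>i\<in>I. u i \<noteq> 0) \<and> (\<Sum>i\<in>I. u i *\<^sub>C y i) = 0"
  proof (cases "inj_on y I")
    case True
    have "complex_vector.dependent (y ` I)"
    proof (rule ccontr)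
      assume "complex_vector.independent (y ` I)"
      then have "card (y ` I) \<le> card B"
        using complex_vector.independent_span_bound[OF B(1)] y by blast
      then show False
        using B(2) True by (simp add: card_image)
    qed
    then obtain w where "\<exists>v\<in>y ` I. w v \<noteq> 0" "(\<Sum>v\<in>y ` I. w v *\<^sub>C v) = 0"
      using complex_vector.dependent_finite[of "y ` I"] I by auto
    then show ?thesis
      using True by (intro exI[of _ "w \<circ> y"]) (auto simp: sum.reindex)
  next
    case False
    then obtain p q where pq: "p \<in> I" "q \<in> I" "p \<noteq> q" "y p = y q"
      by (auto simp: inj_on_def)
    define u :: "'i \<Rightarrow> complex" where "u i = (if i = p then 1 else if i = q then -1 else 0)" for i
    \<comment> \<open>A repeated vector gives a dependence with coefficients \<open>1\<close> and
      \<open>-1\<close>.\<close>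
    have "(\<Sum>i\<in>I. u i *\<^sub>C y i) = (\<Sum>i\<in>{p, q}. u i *\<^sub>C y i)"
      using pq I by (intro sum.mono_neutral_right) (auto simp: u_def)
    also have "\<dots> = 0"
      using pq by (simp add: u_def scaleC_one)
    finally show ?thesis
      using pq by (intro exI[of _ u]) (auto simp: u_def)
  qed
  then obtain u i where u: "(\<Sum>i\<in>I. u i *\<^sub>C y i) = 0" and i: "i \<in> I" "u i \<noteq> 0"
    by blast
  define s where "s = (\<Sum>i\<in>I. cmod (u i))"
  have "s > 0"
    unfolding s_def using I i by (intro sum_pos2[of I i]) auto
  have "(\<Sum>i\<in>I. (u i / s) *\<^sub>C y i) = inverse (complex_of_real s) *\<^sub>C (\<Sum>i\<in>I. u i *\<^sub>C y i)"
    by (simp only: complex_vector.scale_sum_right scaleC_scaleC divide_inverse mult.commute)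
  then have "(\<Sum>i\<in>I. (u i / s) *\<^sub>C y i) = 0"
    by (simp add: u)
  moreover have "(\<Sum>i\<in>I. cmod (u i / s)) = 1"
    using \<open>s > 0\<close> by (simp add: norm_divide flip: sum_divide_distrib s_def)
  ultimately show ?thesis by (rule that)
qed

text \<open>If \<open>I\<close> had at least \<open>k\<close> elements, the sequences representing
  them would be linearly dependent at \<open>U\<close>-almost every \<open>n\<close>. The normalised
  coefficients converge along \<open>U\<close> to a nontrivial dependence in
  \<open>I\<close>.\<close>

lemma bounded_weak_star_limits_independent_card:
  assumes U: "ultrafilter U"
    and B: "eventually (\<lambda>n. finite (B n) \<and> card (B n) < k) U"
    and I: "I \<subseteq> bounded_weak_star_limits U (\<lambda>n. complex_span (B n))"
      "complex_vector.independent I" "finite I"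
  shows "card I < k"
proof (rule ccontr)
  assume "\<not> card I < k"
  have nb: "U \<noteq> bot" using U by (simp add: ultrafilter_def)
  have "\<forall>L\<in>I. \<exists>y. (\<forall>n. y n \<in> complex_span (B n)) \<and> weak_star_limit U y L"
    using I(1) by (auto simp: bounded_weak_star_limits_def)
  then obtain y where y: "\<And>L n. L \<in> I \<Longrightarrow> y L n \<in> complex_span (B n)"
      "\<And>L. L \<in> I \<Longrightarrow> weak_star_limit U (y L) L"
    by metis
  \<comment> \<open>The implication sits inside the existential so that coefficients can be chosen
    at every \<open>n\<close>, arbitrarily at the exceptional ones.\<close>
  have "\<forall>n. \<exists>a. finite (B n) \<and> card (B n) < k \<longrightarrow>
      (\<Sum>L\<in>I. a L *\<^sub>C y L n) = 0 \<and> (\<Sum>L\<in>I. cmod (a L)) = 1"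
  proof
    fix n
    show "\<exists>a. finite (B n) \<and> card (B n) < k \<longrightarrow>
      (\<Sum>L\<in>I. a L *\<^sub>C y L n) = 0 \<and> (\<Sum>L\<in>I. cmod (a L)) = 1"
    proof (cases "finite (B n) \<and> card (B n) < k")
      case True
      then have "finite (B n)" "card (B n) < card I"
        using \<open>\<not> card I < k\<close> by auto
      from normalised_dependence[OF I(3) this, of "\<lambda>L. y L n"] y(1) show ?thesis by blast
    qed blast
  qed
  from choice[OF this] obtain a where a: "\<And>n. finite (B n) \<and> card (B n) < k \<Longrightarrow>
      (\<Sum>L\<in>I. a n L *\<^sub>C y L n) = 0 \<and> (\<Sum>L\<in>I. cmod (a n L)) = 1"
    by blast
  have ev: "eventually (\<lambda>n. (\<Sum>L\<in>I. a n L *\<^sub>C y L n) = 0 \<and> (\<Sum>L\<in>I. cmod (a n L)) = 1) U"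
    using B by eventually_elim (rule a)
  have "\<exists>c. ((\<lambda>n. a n L) \<longlongrightarrow> c) U" if "L \<in> I" for L
  proof -
    have "eventually (\<lambda>n. cmod (a n L) \<le> 1) U"
      using ev
    proof eventually_elim
      case (elim n)
      then show ?case
        using member_le_sum[OF that, of "\<lambda>L. cmod (a n L)"] I(3) by simp
    qed
    from ultrafilter_tendsto_bounded[OF U this] show ?thesis by blast
  qed
  then obtain c where c: "\<And>L. L \<in> I \<Longrightarrow> ((\<lambda>n. a n L) \<longlongrightarrow> c L) U"
    by metis
  \<comment> \<open>The combinations tend to this sum, but they also tend to \<open>0\<close>, being
    eventually zero along \<open>U\<close>.\<close>
  have "(\<Sum>L\<in>I. c L *\<^sub>C L) = 0"
  proof (rule weak_star_limit_unique[OF nb])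
    show "weak_star_limit U (\<lambda>n. \<Sum>L\<in>I. a n L *\<^sub>C y L n) (\<Sum>L\<in>I. c L *\<^sub>C L)"
      by (intro weak_star_limit_sum weak_star_limit_scaleC c y)
    show "weak_star_limit U (\<lambda>n. \<Sum>L\<in>I. a n L *\<^sub>C y L n) 0"
      unfolding weak_star_limit_def
    proof
      fix z
      show "((\<lambda>n. (\<Sum>L\<in>I. a n L *\<^sub>C y L n) *\<^sub>V z) \<longlongrightarrow> 0 *\<^sub>V z) U"
        using ev by (intro tendsto_eventually) (auto elim!: eventually_mono)
    qed
  qed
  then have "\<And>L. L \<in> I \<Longrightarrow> c L = 0"
    using I(2,3) complex_vector.dependent_finite by blast
  moreover have "(\<Sum>L\<in>I. cmod (c L)) = 1"
  proof (rule tendsto_unique[OF nb])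
    show "((\<lambda>n. \<Sum>L\<in>I. cmod (a n L)) \<longlongrightarrow> (\<Sum>L\<in>I. cmod (c L))) U"
      by (intro tendsto_sum tendsto_norm c)
    show "((\<lambda>n. \<Sum>L\<in>I. cmod (a n L)) \<longlongrightarrow> 1) U"
      using ev by (intro tendsto_eventually) (auto elim!: eventually_mono)
  qed
  ultimately show False by simp
qed

text \<open>A maximal independent subset spans the limit space. Were it infinite, it would contain
  an independent set of exactly \<open>k\<close> elements, against the previous bound.\<close>

lemma bounded_weak_star_limits_finite_span:
  assumes U: "ultrafilter U"
    and B: "eventually (\<lambda>n. finite (B n) \<and> card (B n) < k) U"
  obtains A where "finite A" "card A < k"
    "bounded_weak_star_limits U (\<lambda>n. complex_span (B n)) = complex_span A"
proof -
  let ?N = "bounded_weak_star_limits U (\<lambda>n. complex_span (B n))"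
  obtain A where A: "A \<subseteq> ?N" "complex_vector.independent A" "?N \<subseteq> complex_span A"
    by (rule complex_vector.maximal_independent_subset)
  have sub: "card I < k" if "I \<subseteq> A" "finite I" for I
    using bounded_weak_star_limits_independent_card[OF U B _ _ that(2)] that(1) A(1,2)
      complex_vector.independent_mono by blast
  have "finite A"
  proof (rule ccontr)
    assume "infinite A"
    then obtain I where "I \<subseteq> A" "finite I" "card I = k"
      using infinite_arbitrarily_large by blast
    then show False using sub by blast
  qed
  moreover have "?N = complex_span A"
  proof
    show "complex_span A \<subseteq> ?N"
      by (intro complex_vector.span_minimal A subspace_bounded_weak_star_limits
          complex_vector.subspace_span)
  qed (rule A(3))
  ultimately show ?thesis
    using sub that by blast
qed

section \<open>Lower semicontinuity\<close>

text \<open>For each \<open>x\<close>, approximants of \<open>S n *\<^sub>V x\<close> from the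
  chosen subspaces are bounded and have a weak-star limit in the limit space. By lower
  semicontinuity it approximates \<open>T *\<^sub>V x\<close> just as well, and the limit space does
  not depend on \<open>x\<close>.\<close>

lemma kolmogorov_number_weak_star_le:
  fixes T :: "('x::complex_normed_vector, 'z::complex_normed_vector cdual) cblinfun"
  assumes U: "ultrafilter U" and "k \<ge> 1"
    and lim: "\<And>x. weak_star_limit U (\<lambda>n. S n *\<^sub>V x) (T *\<^sub>V x)"
    and bnd: "eventually (\<lambda>n. norm (S n) \<le> r) U"
    and less: "eventually (\<lambda>n. kolmogorov_number k (S n) < c) U"
  shows "kolmogorov_number k T \<le> c"
proof -
  have nb: "U \<noteq> bot" using U by (simp add: ultrafilter_def)
  have "\<exists>B. kolmogorov_number k (S n) < c \<longrightarrow>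
      finite B \<and> card B < k \<and> quotient_onorm (complex_span B) (S n) < c" for n
    using kolmogorov_number_less[OF _ \<open>k \<ge> 1\<close>] by metis
  then obtain B where B: "\<And>n. kolmogorov_number k (S n) < c \<Longrightarrow>
      finite (B n) \<and> card (B n) < k \<and> quotient_onorm (complex_span (B n)) (S n) < c"
    by metis
  have "eventually (\<lambda>n. finite (B n) \<and> card (B n) < k) U"
    using less by eventually_elim (use B in blast)
  then obtain A where A: "finite A" "card A < k"
      "bounded_weak_star_limits U (\<lambda>n. complex_span (B n)) = complex_span A"
    using bounded_weak_star_limits_finite_span[OF U] by blast
  obtain n where n: "kolmogorov_number k (S n) < c"
    using less nb eventually_happens' by blast
  have "0 \<le> quotient_onorm (complex_span (B n)) (S n)"
    by (intro quotient_onorm_nonneg complex_vector.span_zero)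
  with B[OF n] have "0 \<le> c" by simp
  have "quotient_onorm (complex_span A) T \<le> c"
  proof (rule quotient_onorm_le[OF \<open>0 \<le> c\<close>])
    fix x
    \<comment> \<open>At indices without the estimate, \<open>0\<close> serves as approximant, so
      that \<open>v n\<close> lies in the span for every \<open>n\<close>.\<close>
    have "\<exists>v. v \<in> complex_span (B n) \<and>
        (kolmogorov_number k (S n) < c \<longrightarrow> norm (S n *\<^sub>V x - v) \<le> c * norm x)" for n
    proof (cases "kolmogorov_number k (S n) < c")
      case True
      then have "quotient_onorm (complex_span (B n)) (S n) < c" using B by blast
      from quotient_onorm_approx[OF this, of x] show ?thesis by blast
    next
      case False
      then show ?thesis using complex_vector.span_zero by blast
    qed
    then obtain v where v: "\<And>n. v n \<in> complex_span (B n)"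
        "\<And>n. kolmogorov_number k (S n) < c \<Longrightarrow> norm (S n *\<^sub>V x - v n) \<le> c * norm x"
      by metis
    have close: "eventually (\<lambda>n. norm (S n *\<^sub>V x - v n) \<le> c * norm x) U"
      using less by eventually_elim (rule v(2))
    have bv: "eventually (\<lambda>n. norm (v n) \<le> r * norm x + c * norm x) U"
      using close bnd
    proof eventually_elim
      case (elim n)
      have "norm (v n) \<le> norm (S n *\<^sub>V x) + norm (S n *\<^sub>V x - v n)"
        using norm_triangle_ineq4[of "S n *\<^sub>V x" "S n *\<^sub>V x - v n"] by simp
      moreover have "norm (S n *\<^sub>V x) \<le> r * norm x"
        using norm_cblinfun_apply_le[of "S n" x] elim(2)
        by (meson mult_right_mono norm_ge_zero order_trans)
      ultimately show ?case using elim(1) by simp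
    qed
    then obtain L where L: "weak_star_limit U v L"
      using weak_star_limit_exists[OF U] by blast
    have "L \<in> complex_span A"
      unfolding A(3)[symmetric] using v(1) bv L by (rule bounded_weak_star_limitsI)
    then have "quotient_norm (coset (complex_span A) (T *\<^sub>V x)) \<le> norm (T *\<^sub>V x + - L)"
      by (intro quotient_norm_coset_le complex_vector.span_neg)
    also have "\<dots> \<le> c * norm x"
      using weak_star_limit_norm_le[OF nb weak_star_limit_diff[OF lim L] close] by simp
    finally show "quotient_norm (coset (complex_span A) (T *\<^sub>V x)) \<le> c * norm x" .
  qed
  with kolmogorov_number_le[OF A(1,2), of T] show ?thesis by simp
qed

section \<open>Convergence of the Kolmogorov numbers of
  \<open>Q n o\<^sub>C\<^sub>L T\<close>\<close>

theorem theorem10: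
  fixes T :: "('x::complex_banach, 'z::complex_normed_vector cdual) cblinfun"
    and Q :: "nat \<Rightarrow> ('z cdual, 'z cdual) cblinfun"
    and k :: nat
  assumes "\<not> finite_cdim (UNIV :: 'x set)"
    and "\<not> finite_cdim (UNIV :: 'z cdual set)"
    and "\<And>n. n \<ge> 1 \<Longrightarrow> norm (Q n) \<le> 1"
    and "weak_star_converges (\<lambda>n. Q n o\<^sub>C\<^sub>L T) T"
    and "k \<ge> 1"
  shows "(\<lambda>n. kolmogorov_number k (Q n o\<^sub>C\<^sub>L T)) \<longlonglongrightarrow> kolmogorov_number k T"
proof (rule order_tendstoI)
  let ?S = "\<lambda>n. Q n o\<^sub>C\<^sub>L T"
  fix b assume b: "kolmogorov_number k T < b"
  show "eventually (\<lambda>n. kolmogorov_number k (?S n) < b) sequentially"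
  \<comment> \<open>The indices start at \<open>1\<close>, where the bound on \<open>Q n\<close>
    begins.\<close>
  proof (rule eventually_sequentiallyI)
    fix n :: nat assume "1 \<le> n"
    from kolmogorov_number_compose_le[OF assms(3)[OF this] assms(5)] b
    show "kolmogorov_number k (?S n) < b" by (rule order_le_less_trans)
  qed
next
  let ?S = "\<lambda>n. Q n o\<^sub>C\<^sub>L T"
  fix b assume b: "b < kolmogorov_number k T"
  show "eventually (\<lambda>n. b < kolmogorov_number k (?S n)) sequentially"
  proof (rule ccontr)
    assume "\<not> eventually (\<lambda>n. b < kolmogorov_number k (?S n)) sequentially"
    \<comment> \<open>The bad indices occur infinitely often, so the tails restricted to them form a
      proper filter, which an ultrafilter refines.\<close>
    then have "inf sequentially (principal {n. kolmogorov_number k (?S n) \<le> b}) \<noteq> bot"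
      by (simp add: trivial_limit_def eventually_inf_principal not_le)
    then obtain U where Ule: "U \<le> inf sequentially (principal {n. kolmogorov_number k (?S n) \<le> b})"
        and U: "ultrafilter U"
      by (rule ultrafilter_exists)
    have seq: "U \<le> sequentially" and evb: "eventually (\<lambda>n. kolmogorov_number k (?S n) \<le> b) U"
      using Ule by (auto simp: le_principal)
    \<comment> \<open>Along \<open>U\<close> only \<open>\<le> b\<close> is known; an intermediate
      \<open>c\<close> gives the strict bound needed to select subspaces.\<close>
    obtain c where c: "b < c" "c < kolmogorov_number k T"
      using b dense by blast
    have "kolmogorov_number k T \<le> c"
    proof (rule kolmogorov_number_weak_star_le[OF U \<open>k \<ge> 1\<close>])
      fix x
      have "(\<lambda>n. (?S n *\<^sub>V x) *\<^sub>V z) \<longlonglongrightarrow> (T *\<^sub>V x) *\<^sub>V z" for z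
        using assms(4) unfolding weak_star_converges_def
        by (metis LIM_zero_cancel tendsto_norm_zero_cancel)
      then show "weak_star_limit U (\<lambda>n. ?S n *\<^sub>V x) (T *\<^sub>V x)"
        unfolding weak_star_limit_def using tendsto_mono[OF seq] by blast
    next
      have "norm (?S n) \<le> norm T" if "n \<ge> 1" for n
      proof (rule norm_cblinfun_bound)
        fix x
        have "norm (?S n *\<^sub>V x) \<le> norm (Q n) * norm (T *\<^sub>V x)"
          unfolding cblinfun_compose_apply by (rule norm_cblinfun_apply_le)
        also have "\<dots> \<le> norm (T *\<^sub>V x)"
          using assms(3)[OF that] by (simp add: mult_left_le_one_le)
        finally show "norm (?S n *\<^sub>V x) \<le> norm T * norm x"
          using norm_cblinfun_apply_le[of T x] by simp
      qed simp
      then show "eventually (\<lambda>n. norm (?S n) \<le> norm T) U"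
        by (intro filter_leD[OF seq] eventually_sequentiallyI[of 1])
    next
      show "eventually (\<lambda>n. kolmogorov_number k (?S n) < c) U"
        using evb by eventually_elim (use c(1) in simp)
    qed
    with c(2) show False by simp
  qed
qed

end
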